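(* Let $V$ be a vector space of finite dimension over the finite field $\mathbb{F}_q$, let $G$ be an irreducible subgroup of $\mathrm{GL}(V)$, and let $H$ be a proper subgroup of $G$. Then $$-\mu_{\widehat{\mathcal{I}}(G,H)}(H,G)=\sum_{E\in\Psi'(G,H)}(-1)^{|E|}=\sum_{X\in\Psi(G,H)}(-1)^{|X|}=-\tilde{\chi}(\Delta_1)=-\tilde{\chi}(\Delta_2).$$
   Context: $G\le \mathrm{GL}(V)$ acts naturally on the set of subspaces of $V$; $\mathrm{stab}_G(W)=\{g\in G\mid gW=W\}$. A subgroup of $\mathrm{GL}(V)$ is reducible if it fixes (setwise) some subspace $W$ with $0<W<V$, and irreducible otherwise. Möbius function: for a finite poset $\mathcal{P}$, $\mu_{\mathcal{P}}:\mathcal{P}\times\mathcal{P}\to\mathbb{Z}$ is defined by $\mu_{\mathcal{P}}(x,y)=0$ unless $x\le y$, $\mu_{\mathcal{P}}(x,x)=1$, and $\sum_{x\le t\le y}\mu_{\mathcal{P}}(x,t)=0$ if $x<y$. Define - $\mathcal{C}(G,H)=\{\mathrm{stab}_G(W)\mid 0<W<V,\ H\subseteq \mathrm{stab}_G(W)\}$ (a set of subgroups of $G$). - $\mathcal{I}(G,H)=\{K\le G\mid H\le K\le M\text{ for some }M\in\mathcal{C}(G,H)\}$. - $\widehat{\mathcal{I}}(G,H)$, a poset ordered by inclusion: if $H$ is reducible, $\widehat{\mathcal{I}}(G,H)=\mathcal{I}(G,H)\cup\{G\}$; if $H$ is irreducible (so that $\mathcal{I}(G,H)=\emptyset$), $\widehat{\mathcal{I}}(G,H)=\{H,G\}$.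 - $\mathcal{S}(V,H)^*$ is the set of $H$-invariant subspaces of $V$ other than $0$ and $V$. - $\Psi(G,H)=\{X\subseteq\mathcal{C}(G,H)\mid \bigcap_{M\in X}M\ne H\}$. - $\Psi'(G,H)=\{E\subseteq\mathcal{S}(V,H)^*\mid \bigcap_{W\in E}\mathrm{stab}_G(W)\ne H\}$. The empty intersection is $G$, so $\emptyset\in\Psi(G,H)$ and $\emptyset\in\Psi'(G,H)$. Simplicial complexes: a simplicial complex is a collection of subsets (faces) of a vertex set that contains all singletons of vertices and is closed under taking subsets; the empty set is a face (of dimension $-1$) of any nonempty complex, and a face $F$ has dimension $|F|-1$. $\Delta_1$ is the simplicial complex with vertex set $\{W\in\mathcal{S}(V,H)^*\mid \mathrm{stab}_G(W)\ne H\}$ and set of faces $\Psi'(G,H)$. $\Delta_2$ is the simplicial complex with vertex set $\{M\in\mathcal{C}(G,H)\mid M\ne H\}$ and set of faces $\Psi(G,H)$. The Euler characteristic of $\Delta$ is $\chi(\Delta)=\sum_{i\ge 0}(-1)^i f_i$, where $f_i$ is the number of faces of dimension $i$. The reduced Euler characteristic is $\tilde{\chi}(\Delta)=0$ if $\Delta=\emptyset$ (no faces at all), and $\tilde{\chi}(\Delta)=\chi(\Delta)-1$ if $\Delta\neq\emptyset$. *)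

theory Defs
  imports Complex_Main "HOL-Algebra.Group"
begin

section \<open>Linear groups on the vector space carried by a type\<close>

text \<open>
  Throughout, \<open>V\<close> is the whole type \<open>'v\<close>, made into a vector space by \<open>scale\<close>,
  and subgroups of \<open>GL(V)\<close> are sets of functions \<open>'v \<Rightarrow> 'v\<close>.
\<close>

definition general_linear ::
    "('k::field \<Rightarrow> 'v::ab_group_add \<Rightarrow> 'v) \<Rightarrow> ('v \<Rightarrow> 'v) monoid" where
  "general_linear scale =
     \<lparr>carrier = {f. Vector_Spaces.linear scale scale f \<and> bij f}, mult = (\<circ>), one = id\<rparr>"

definition proper_subspaces :: "('k::field \<Rightarrow> 'v::ab_group_add \<Rightarrow> 'v) \<Rightarrow> 'v set set" where
  "proper_subspaces scale = {W. module.subspace scale W \<and> {0} \<subset> W \<and> W \<subset> UNIV}"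

definition subspace_stab :: "('v \<Rightarrow> 'v) set \<Rightarrow> 'v set \<Rightarrow> ('v \<Rightarrow> 'v) set" where
  "subspace_stab G W = {g \<in> G. g ` W = W}"

definition invariant_subspaces ::
    "('k::field \<Rightarrow> 'v::ab_group_add \<Rightarrow> 'v) \<Rightarrow> ('v \<Rightarrow> 'v) set \<Rightarrow> 'v set set" where
  "invariant_subspaces scale H = {W \<in> proper_subspaces scale. \<forall>h\<in>H. h ` W = W}"

definition linear_reducible ::
    "('k::field \<Rightarrow> 'v::ab_group_add \<Rightarrow> 'v) \<Rightarrow> ('v \<Rightarrow> 'v) set \<Rightarrow> bool" where
  "linear_reducible scale G \<longleftrightarrow> (\<exists>W\<in>proper_subspaces scale. \<forall>g\<in>G. g ` W = W)"

abbreviation linear_irreducible ::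
    "('k::field \<Rightarrow> 'v::ab_group_add \<Rightarrow> 'v) \<Rightarrow> ('v \<Rightarrow> 'v) set \<Rightarrow> bool" where
  "linear_irreducible scale G \<equiv> \<not> linear_reducible scale G"

lemma group_general_linear:
  assumes "vector_space scale"
  shows "group (general_linear scale)"
proof -
  interpret vector_space scale by fact
  interpret vector_space_pair scale scale by unfold_locales
  show ?thesis
  proof (rule groupI)
    fix f assume "f \<in> carrier (general_linear scale)"
    then have f: "Vector_Spaces.linear scale scale f" "bij f"
      by (auto simp: general_linear_def)
    then interpret f: Vector_Spaces.linear scale scale f by simp
    have "f (inv_into UNIV f x) = x" for x
      using f by (simp add: bij_is_surj surj_f_inv_f)
    then have "Vector_Spaces.linear scale scale (inv_into UNIV f)"
      using f by unfold_locales (metis bij_inv_eq_iff f.add, metis bij_inv_eq_iff f.scale)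
    then show "\<exists>g\<in>carrier (general_linear scale).
        g \<otimes>\<^bsub>general_linear scale\<^esub> f = \<one>\<^bsub>general_linear scale\<^esub>"
      using f by (auto simp: general_linear_def bij_imp_bij_inv bij_is_inj intro!: bexI[of _ "inv_into UNIV f"])
  qed (auto simp: general_linear_def o_assoc linear_id
        intro: Vector_Spaces.linear_compose bij_comp)
qed


section \<open>The Moebius function of a finite poset\<close>

text \<open>
  The poset is \<open>P\<close> with the order of the ambient type (inclusion, in the case of sets).
  The recursion solves the condition that the values over an interval sum to 0 for the last one;
  it yields 0 by convention if \<open>P\<close> is infinite.
\<close>

function moebius :: "'a::order set \<Rightarrow> 'a \<Rightarrow> 'a \<Rightarrow> int" where
  "moebius P x y =
     (if finite P \<and> x \<in> P \<and> y \<in> P \<and> x \<le> y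
      then if x = y then 1 else - (\<Sum>t\<in>{t\<in>P. x \<le> t \<and> t < y}. moebius P x t)
      else 0)"
  by auto
termination
proof (relation "measure (\<lambda>(P, x, y). card {t\<in>P. t < y})", goal_cases)
  case (2 P x y t)
  then have "{s\<in>P. s < t} \<subset> {s\<in>P. s < y}" by force
  with 2 show ?case by (auto intro: psubset_card_mono)
qed simp

declare moebius.simps [simp del]

lemma moebius_not_le: "\<not> x \<le> y \<Longrightarrow> moebius P x y = 0"
  by (simp add: moebius.simps)

lemma moebius_refl: "finite P \<Longrightarrow> x \<in> P \<Longrightarrow> moebius P x x = 1"
  by (simp add: moebius.simps)

lemma sum_moebius:
  assumes "finite P" "x \<in> P" "y \<in> P" "x < y"
  shows "(\<Sum>t\<in>{t\<in>P. x \<le> t \<and> t \<le> y}. moebius P x t) = 0"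
proof -
  have "{t\<in>P. x \<le> t \<and> t \<le> y} = insert y {t\<in>P. x \<le> t \<and> t < y}"
    using assms by auto
  moreover have "moebius P x y = - (\<Sum>t\<in>{t\<in>P. x \<le> t \<and> t < y}. moebius P x t)"
    using assms by (subst moebius.simps) auto
  ultimately show ?thesis
    using assms by simp
qed


section \<open>Simplicial complexes\<close>

text \<open>A complex is a pair of its vertex set and its set of faces.\<close>

type_synonym 'a vertices_and_faces = "'a set \<times> 'a set set"

definition simplicial_complex :: "'a vertices_and_faces \<Rightarrow> bool" where
  "simplicial_complex D \<longleftrightarrow>
     (\<forall>F\<in>snd D. F \<subseteq> fst D) \<and> (\<forall>v\<in>fst D. {v} \<in> snd D) \<and> (\<forall>F\<in>snd D. \<forall>E\<subseteq>F. E \<in> snd D)"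

definition face_dim :: "'a set \<Rightarrow> int" where
  "face_dim F = int (card F) - 1"

definition face_number :: "'a vertices_and_faces \<Rightarrow> nat \<Rightarrow> nat" where
  "face_number D i = card {F \<in> snd D. face_dim F = int i}"

text \<open>The sum over all \<open>i \<ge> 0\<close> is restricted to its nonzero terms to make it a finite sum.\<close>

definition euler_char :: "'a vertices_and_faces \<Rightarrow> int" where
  "euler_char D = (\<Sum>i | face_number D i \<noteq> 0. (- 1) ^ i * int (face_number D i))"

definition reduced_euler_char :: "'a vertices_and_faces \<Rightarrow> int" where
  "reduced_euler_char D = (if snd D = {} then 0 else euler_char D - 1)"


section \<open>The posets and complexes attached to a pair of groups\<close>

definition stab_set ::
    "('k::field \<Rightarrow> 'v::ab_group_add \<Rightarrow> 'v) \<Rightarrow> ('v \<Rightarrow> 'v) set \<Rightarrow> ('v \<Rightarrow> 'v) set \<Rightarrow> ('v \<Rightarrow> 'v) set set" where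
  "stab_set scale G H =
     {subspace_stab G W | W. W \<in> proper_subspaces scale \<and> H \<subseteq> subspace_stab G W}"

definition reducible_interval ::
    "('k::field \<Rightarrow> 'v::ab_group_add \<Rightarrow> 'v) \<Rightarrow> ('v \<Rightarrow> 'v) set \<Rightarrow> ('v \<Rightarrow> 'v) set \<Rightarrow> ('v \<Rightarrow> 'v) set set" where
  "reducible_interval scale G H =
     {K. subgroup K (general_linear scale) \<and> K \<subseteq> G \<and> (\<exists>M\<in>stab_set scale G H. H \<subseteq> K \<and> K \<subseteq> M)}"

definition reducible_interval_hat ::
    "('k::field \<Rightarrow> 'v::ab_group_add \<Rightarrow> 'v) \<Rightarrow> ('v \<Rightarrow> 'v) set \<Rightarrow> ('v \<Rightarrow> 'v) set \<Rightarrow> ('v \<Rightarrow> 'v) set set" where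
  "reducible_interval_hat scale G H =
     (if linear_reducible scale H then reducible_interval scale G H \<union> {G} else {H, G})"

text \<open>
  Members of the families intersected below are subsets of \<open>G\<close>, so intersecting with \<open>G\<close>
  only serves to make the empty intersection equal to \<open>G\<close>.
\<close>

definition Psi_stabs ::
    "('k::field \<Rightarrow> 'v::ab_group_add \<Rightarrow> 'v) \<Rightarrow> ('v \<Rightarrow> 'v) set \<Rightarrow> ('v \<Rightarrow> 'v) set \<Rightarrow> ('v \<Rightarrow> 'v) set set set" where
  "Psi_stabs scale G H = {X. X \<subseteq> stab_set scale G H \<and> G \<inter> (\<Inter>M\<in>X. M) \<noteq> H}"

definition Psi_subspaces ::
    "('k::field \<Rightarrow> 'v::ab_group_add \<Rightarrow> 'v) \<Rightarrow> ('v \<Rightarrow> 'v) set \<Rightarrow> ('v \<Rightarrow> 'v) set \<Rightarrow> 'v set set set" where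
  "Psi_subspaces scale G H =
     {E. E \<subseteq> invariant_subspaces scale H \<and> G \<inter> (\<Inter>W\<in>E. subspace_stab G W) \<noteq> H}"

definition Delta1 ::
    "('k::field \<Rightarrow> 'v::ab_group_add \<Rightarrow> 'v) \<Rightarrow> ('v \<Rightarrow> 'v) set \<Rightarrow> ('v \<Rightarrow> 'v) set \<Rightarrow> 'v set vertices_and_faces" where
  "Delta1 scale G H =
     ({W \<in> invariant_subspaces scale H. subspace_stab G W \<noteq> H}, Psi_subspaces scale G H)"

definition Delta2 ::
    "('k::field \<Rightarrow> 'v::ab_group_add \<Rightarrow> 'v) \<Rightarrow> ('v \<Rightarrow> 'v) set \<Rightarrow> ('v \<Rightarrow> 'v) set \<Rightarrow> ('v \<Rightarrow> 'v) set vertices_and_faces" where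
  "Delta2 scale G H = ({M \<in> stab_set scale G H. M \<noteq> H}, Psi_stabs scale G H)"

lemma simplicial_complex_Delta1:
  assumes "H \<subseteq> G"
  shows "simplicial_complex (Delta1 scale G H)"
proof -
  have sub: "H \<subseteq> subspace_stab G W" "subspace_stab G W \<subseteq> G"
    if "W \<in> invariant_subspaces scale H" for W
    using that assms by (auto simp: invariant_subspaces_def subspace_stab_def)
  have down: "E \<in> Psi_subspaces scale G H" if "F \<in> Psi_subspaces scale G H" "E \<subseteq> F" for E F
  proof -
    have "H \<subseteq> G \<inter> (\<Inter>W\<in>F. subspace_stab G W)"
    proof (intro Int_greatest INT_greatest assms sub(1))
      show "W \<in> invariant_subspaces scale H" if "W \<in> F" for W
        using that \<open>F \<in> Psi_subspaces scale G H\<close> by (auto simp: Psi_subspaces_def)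
    qed
    moreover have "G \<inter> (\<Inter>W\<in>F. subspace_stab G W) \<subseteq> G \<inter> (\<Inter>W\<in>E. subspace_stab G W)"
      using that by blast
    moreover have "G \<inter> (\<Inter>W\<in>F. subspace_stab G W) \<noteq> H" "E \<subseteq> invariant_subspaces scale H"
      using that by (auto simp: Psi_subspaces_def)
    ultimately show ?thesis
      unfolding Psi_subspaces_def mem_Collect_eq by (metis subset_antisym)
  qed
  have single: "{W} \<in> Psi_subspaces scale G H \<longleftrightarrow>
      W \<in> invariant_subspaces scale H \<and> subspace_stab G W \<noteq> H" for W
    by (auto simp: Psi_subspaces_def subspace_stab_def)
  show ?thesis
    unfolding simplicial_complex_def Delta1_def fst_conv snd_conv
  proof (intro conjI ballI allI impI)
    fix F assume F: "F \<in> Psi_subspaces scale G H"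
    show "F \<subseteq> {W \<in> invariant_subspaces scale H. subspace_stab G W \<noteq> H}"
    proof
      fix W assume "W \<in> F"
      then have "{W} \<in> Psi_subspaces scale G H" by (intro down[OF F]) simp
      then show "W \<in> {W \<in> invariant_subspaces scale H. subspace_stab G W \<noteq> H}"
        by (simp add: single)
    qed
  next
    show "E \<in> Psi_subspaces scale G H" if "F \<in> Psi_subspaces scale G H" "E \<subseteq> F" for F E
      using that by (rule down)
  qed (simp add: single)
qed

lemma simplicial_complex_Delta2:
  assumes "H \<subseteq> G"
  shows "simplicial_complex (Delta2 scale G H)"
proof -
  have sub: "H \<subseteq> M" "M \<subseteq> G" if "M \<in> stab_set scale G H" for M
    using that by (auto simp: stab_set_def subspace_stab_def)
  have down: "E \<in> Psi_stabs scale G H" if "F \<in> Psi_stabs scale G H" "E \<subseteq> F" for E F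
  proof -
    have "H \<subseteq> G \<inter> (\<Inter>M\<in>F. M)"
    proof (intro Int_greatest INT_greatest assms sub(1))
      show "M \<in> stab_set scale G H" if "M \<in> F" for M
        using that \<open>F \<in> Psi_stabs scale G H\<close> by (auto simp: Psi_stabs_def)
    qed
    moreover have "G \<inter> (\<Inter>M\<in>F. M) \<subseteq> G \<inter> (\<Inter>M\<in>E. M)"
      using that by blast
    moreover have "G \<inter> (\<Inter>M\<in>F. M) \<noteq> H" "E \<subseteq> stab_set scale G H"
      using that by (auto simp: Psi_stabs_def)
    ultimately show ?thesis
      unfolding Psi_stabs_def mem_Collect_eq by (metis subset_antisym)
  qed
  have single: "{M} \<in> Psi_stabs scale G H \<longleftrightarrow> M \<in> stab_set scale G H \<and> M \<noteq> H" for M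
    unfolding Psi_stabs_def using sub(2)[of M] by blast
  show ?thesis
    unfolding simplicial_complex_def Delta2_def fst_conv snd_conv
  proof (intro conjI ballI allI impI)
    fix F assume F: "F \<in> Psi_stabs scale G H"
    show "F \<subseteq> {M \<in> stab_set scale G H. M \<noteq> H}"
    proof
      fix M assume "M \<in> F"
      then have "{M} \<in> Psi_stabs scale G H" by (intro down[OF F]) simp
      then show "M \<in> {M \<in> stab_set scale G H. M \<noteq> H}"
        by (simp add: single)
    qed
  next
    show "E \<in> Psi_stabs scale G H" if "F \<in> Psi_stabs scale G H" "E \<subseteq> F" for F E
      using that by (rule down)
  qed (simp add: single)
qed

end

theory Submission
  imports Defs
begin

text \<open>
  The equalities come from a crosscut theorem. Let \<open>P\<close> be a finite poset of sets with least
  element \<open>H\<close> and greatest element \<open>G\<close>, and let \<open>\<phi> a\<close>, for \<open>a \<in> A\<close>, be sets that do not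
  contain \<open>G\<close>, such that every element of \<open>P\<close> other than \<open>G\<close> is contained in some \<open>\<phi> a\<close> and
  every set \<open>m E = G \<inter> (\<Inter>a\<in>E. \<phi> a)\<close> belongs to \<open>P\<close>. Consider
  the sum of \<open>\<mu>(H, K) (- 1)\<^bsup>|E|\<^esup>\<close> over all pairs with \<open>K \<subseteq> m E\<close>. For fixed \<open>K\<close>, the
  sets \<open>E\<close> are the subsets of \<open>{a. K \<subseteq> \<phi> a}\<close>, whose signs cancel unless \<open>K = G\<close>; for fixed
  \<open>E\<close>, the values \<open>\<mu>(H, K)\<close> over the interval from \<open>H\<close> to \<open>m E\<close> cancel unless \<open>m E = H\<close>.
  Hence \<open>\<mu>(H, G)\<close> is the sum of \<open>(- 1)\<^bsup>|E|\<^esup>\<close> over the \<open>E\<close> with \<open>m E = H\<close>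
  (\<open>moebius_eq_alternating_sum\<close>). If \<open>H \<noteq> G\<close> then \<open>A\<close> is nonempty, the signs of all subsets
  of \<open>A\<close> add up to 0, and \<open>- \<mu>(H, G)\<close> is the sum over the complementary family, \<open>m E \<noteq> H\<close>.

  If \<open>H\<close> is reducible, the hypotheses hold for the subgroups between \<open>H\<close> and \<open>G\<close> that are
  reducible through a subspace fixed by \<open>H\<close>, with \<open>G\<close> itself added: \<open>G\<close> lies in no
  stabilizer because it is irreducible, and intersections of stabilizers are subgroups. The family
  \<open>\<phi>\<close> may repeat values, so the stabilizers can be indexed either by themselves or by the invariant
  subspaces; this gives both alternating sums, without comparing them directly although distinct
  subspaces may have the same stabilizer. If \<open>H\<close> is irreducible, both families are empty and
  everything equals 1 (\<open>minus_moebius_reducible_interval_hat\<close>).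

  The families \<open>m E \<noteq> H\<close> are the faces of the two complexes, the empty face included, and a face
  of dimension \<open>i\<close> has \<open>i + 1\<close> elements; so their alternating sums are the negatives of the
  reduced Euler characteristics (\<open>minus_reduced_euler_char\<close>).
\<close>

section \<open>A crosscut theorem for indexed families of sets\<close>

lemma sum_Pow_minus_one:
  assumes "finite A"
  shows "(\<Sum>E\<in>Pow A. (- 1) ^ card E) = (if A = {} then 1 else 0 :: int)"
  using prod_diff_conv_sum[OF assms, of "\<lambda>_. 1 :: int" "\<lambda>_. 1"] assms by (simp add: power_0_left)

text \<open>
  A crosscut is usually a set of elements of the poset. Here it is an indexed family with possible
  repetitions, because distinct subspaces can have the same stabilizer.
\<close>

lemma moebius_eq_alternating_sum:
  fixes P :: "'a set set" and \<phi> :: "'i \<Rightarrow> 'a set"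
  assumes "finite P" "finite A" "H \<in> P" "G \<in> P"
    and bounds: "\<And>K. K \<in> P \<Longrightarrow> H \<subseteq> K \<and> K \<subseteq> G"
    and closed: "\<And>E. E \<subseteq> A \<Longrightarrow> G \<inter> (\<Inter>a\<in>E. \<phi> a) \<in> P"
    and cover: "\<And>K. K \<in> P \<Longrightarrow> K \<noteq> G \<Longrightarrow> \<exists>a\<in>A. K \<subseteq> \<phi> a"
    and proper: "\<And>a. a \<in> A \<Longrightarrow> \<not> G \<subseteq> \<phi> a"
  shows "moebius P H G = (\<Sum>E | E \<subseteq> A \<and> G \<inter> (\<Inter>a\<in>E. \<phi> a) = H. (- 1) ^ card E)"
proof -
  define m where "m E = G \<inter> (\<Inter>a\<in>E. \<phi> a)" for E
  have above: "(\<Sum>E\<in>{E \<in> Pow A. K \<subseteq> m E}. (- 1) ^ card E) = (if K = G then 1 else 0 :: int)"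
    if "K \<in> P" for K
  proof -
    have "{E \<in> Pow A. K \<subseteq> m E} = Pow {a \<in> A. K \<subseteq> \<phi> a}"
      using bounds[OF that] by (auto simp: m_def)
    moreover have "{a \<in> A. K \<subseteq> \<phi> a} = {} \<longleftrightarrow> K = G"
      using cover[OF that] proper by blast
    ultimately show ?thesis
      using \<open>finite A\<close> by (simp add: sum_Pow_minus_one)
  qed
  have below: "(\<Sum>K\<in>{K \<in> P. K \<subseteq> m E}. moebius P H K) = (if m E = H then 1 else 0)"
    if "E \<in> Pow A" for E
  proof -
    have mE: "m E \<in> P" using closed that by (simp add: m_def)
    have eq: "{K \<in> P. K \<subseteq> m E} = {K \<in> P. H \<subseteq> K \<and> K \<subseteq> m E}"
      using bounds by blast
    show ?thesis
    proof (cases "m E = H")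
      case True
      then have "{K \<in> P. K \<subseteq> m E} = {H}"
        using bounds \<open>H \<in> P\<close> by blast
      then show ?thesis using True assms by (simp add: moebius_refl)
    next
      case False
      then have "H < m E" using bounds[OF mE] by blast
      then show ?thesis using False sum_moebius[OF \<open>finite P\<close> \<open>H \<in> P\<close> mE] by (simp add: eq)
    qed
  qed
  have "moebius P H G = (\<Sum>K\<in>P. moebius P H K * (if K = G then 1 else 0))"
    using assms by (simp add: if_distrib cong: if_cong)
  also have "\<dots> = (\<Sum>K\<in>P. \<Sum>E\<in>{E \<in> Pow A. K \<subseteq> m E}. moebius P H K * (- 1) ^ card E)"
    by (intro sum.cong refl) (simp only: above flip: sum_distrib_left)
  \<comment> \<open>After the interchange, the inner sums run over the intervals from \<open>H\<close> to \<open>m E\<close>.\<close>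
  also have "\<dots> = (\<Sum>E\<in>Pow A. \<Sum>K\<in>{K \<in> P. K \<subseteq> m E}. moebius P H K * (- 1) ^ card E)"
    using assms by (intro sum.swap_restrict) auto
  also have "\<dots> = (\<Sum>E\<in>Pow A. if m E = H then (- 1) ^ card E else 0)"
    by (intro sum.cong) (simp_all add: below flip: sum_distrib_right)
  also have "\<dots> = (\<Sum>E\<in>{E \<in> Pow A. m E = H}. (- 1) ^ card E)"
    using \<open>finite A\<close> by (intro sum.inter_filter[symmetric]) simp
  finally show ?thesis by (simp add: m_def)
qed

text \<open>
  With \<open>H \<noteq> G\<close> the covering condition at \<open>H\<close> makes \<open>A\<close> nonempty, so half of its
  subsets are even and the two complementary sums add up to 0.
\<close>

corollary minus_moebius_eq_alternating_sum:
  fixes P :: "'a set set" and \<phi> :: "'i \<Rightarrow> 'a set"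
  assumes "finite P" "finite A" "H \<in> P" "G \<in> P" "H \<noteq> G"
    and "\<And>K. K \<in> P \<Longrightarrow> H \<subseteq> K \<and> K \<subseteq> G"
    and "\<And>E. E \<subseteq> A \<Longrightarrow> G \<inter> (\<Inter>a\<in>E. \<phi> a) \<in> P"
    and cover: "\<And>K. K \<in> P \<Longrightarrow> K \<noteq> G \<Longrightarrow> \<exists>a\<in>A. K \<subseteq> \<phi> a"
    and "\<And>a. a \<in> A \<Longrightarrow> \<not> G \<subseteq> \<phi> a"
  shows "- moebius P H G = (\<Sum>E | E \<subseteq> A \<and> G \<inter> (\<Inter>a\<in>E. \<phi> a) \<noteq> H. (- 1) ^ card E)"
proof -
  have "A \<noteq> {}" using cover[OF \<open>H \<in> P\<close> \<open>H \<noteq> G\<close>] by blast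
  let ?S = "\<lambda>Q. \<Sum>E | E \<subseteq> A \<and> Q (G \<inter> (\<Inter>a\<in>E. \<phi> a)). (- 1) ^ card E :: int"
  have "?S (\<lambda>K. K = H) + ?S (\<lambda>K. K \<noteq> H) = (\<Sum>E\<in>Pow A. (- 1) ^ card E)"
    using \<open>finite A\<close> by (subst sum.union_disjoint[symmetric]) (auto intro!: sum.cong)
  also have "\<dots> = 0"
    using \<open>finite A\<close> \<open>A \<noteq> {}\<close> by (simp add: sum_Pow_minus_one)
  finally show ?thesis
    using moebius_eq_alternating_sum[of P A H G \<phi>] assms by simp
qed

section \<open>The reduced Euler characteristic as an alternating sum\<close>

text \<open>
  The shift between cardinality and dimension accounts for the sign, and the empty face, of dimension
  \<open>- 1\<close>, accounts for the summand by which the reduced and the plain Euler characteristic differ.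
\<close>

lemma minus_reduced_euler_char:
  assumes fin: "finite (snd D)" and faces: "\<And>F. F \<in> snd D \<Longrightarrow> finite F" and "{} \<in> snd D"
  shows "- reduced_euler_char D = (\<Sum>F\<in>snd D. (- 1) ^ card F)"
proof -
  define N where "N = snd D - {{}}"
  have dim: "face_dim F = int i \<longleftrightarrow> F \<noteq> {} \<and> card F - 1 = i" if "F \<in> snd D" for F i
    using faces[OF that] by (cases "card F") (auto simp: face_dim_def)
  have number: "face_number D i = card {F \<in> N. card F - 1 = i}" for i
    unfolding face_number_def N_def by (rule arg_cong[of _ _ card]) (auto simp: dim)
  have "finite N" using fin by (simp add: N_def)
  then have "{i. face_number D i \<noteq> 0} = (\<lambda>F. card F - 1) ` N"
    by (auto simp: number card_eq_0_iff)
  then have "euler_char D = (\<Sum>i\<in>(\<lambda>F. card F - 1) ` N. (- 1) ^ i * int (card {F \<in> N. card F - 1 = i}))"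
    by (simp add: euler_char_def number)
  also have "\<dots> = (\<Sum>i\<in>(\<lambda>F. card F - 1) ` N. \<Sum>F\<in>{F \<in> N. card F - 1 = i}. (- 1) ^ (card F - 1))"
    by (intro sum.cong) (auto simp: mult.commute)
  also have "\<dots> = (\<Sum>F\<in>N. (- 1) ^ (card F - 1))"
    using \<open>finite N\<close> by (rule sum.image_gen[symmetric])
  also have "\<dots> = (\<Sum>F\<in>N. - ((- 1) ^ card F))"
  proof (intro sum.cong refl)
    fix F assume "F \<in> N"
    then have "card F \<noteq> 0" using faces by (auto simp: N_def)
    then show "(- 1) ^ (card F - 1) = - ((- 1) ^ card F :: int)" by (cases "card F") auto
  qed
  finally have "- euler_char D = (\<Sum>F\<in>N. (- 1) ^ card F)"
    by (simp add: sum_negf)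
  moreover have "(\<Sum>F\<in>snd D. (- 1) ^ card F) = 1 + (\<Sum>F\<in>N. (- 1) ^ card F :: int)"
    unfolding N_def using assms by (subst sum.remove[of _ "{}"]) auto
  ultimately show ?thesis
    using assms by (auto simp: reduced_euler_char_def)
qed

section \<open>Stabilizers of subspaces\<close>

lemma finite_set_of_sets:
  assumes "finite (UNIV :: 'a set)"
  shows "finite (S :: 'a set set)"
  by (rule finite_subset[OF _ iffD2[OF finite_Pow_iff assms]]) simp

lemma finite_UNIV_if_finite_dimensional:
  fixes scale :: "'k::{field,finite} \<Rightarrow> 'v::ab_group_add \<Rightarrow> 'v"
  assumes "finite_dimensional_vector_space scale Basis"
  shows "finite (UNIV :: 'v set)"
proof -
  interpret finite_dimensional_vector_space scale Basis by fact
  \<comment> \<open>Adding a generator multiplies the size of a span by at most the number of scalars.\<close>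
  have "finite S \<Longrightarrow> finite (span S)" for S
  proof (induction S rule: finite_induct)
    case (insert a S)
    have "span (insert a S) \<subseteq> (\<lambda>(k, y). scale k a + y) ` (UNIV \<times> span S)"
    proof
      fix x assume "x \<in> span (insert a S)"
      then obtain k where "x - scale k a \<in> span S" by (auto simp: span_insert)
      then show "x \<in> (\<lambda>(k, y). scale k a + y) ` (UNIV \<times> span S)"
        by (intro image_eqI[of _ _ "(k, x - scale k a)"]) auto
    qed
    then show ?case by (rule finite_subset) (simp add: insert)
  qed simp
  from this[OF finite_Basis] show ?thesis by (simp add: span_Basis)
qed

text \<open>
  The group acts on the subsets of the space, and this is the pointwise stabilizer of the family
  \<open>E\<close>; the factor \<open>G\<close> makes it all of \<open>G\<close> if \<open>E\<close> is empty.
\<close>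

lemma subgroup_Int_subspace_stabs:
  assumes "vector_space scale" "subgroup G (general_linear scale)"
  shows "subgroup (G \<inter> (\<Inter>W\<in>E. subspace_stab G W)) (general_linear scale)"
proof -
  interpret GL: group "general_linear scale" by (rule group_general_linear) fact
  interpret G: subgroup G "general_linear scale" by fact
  have eq: "G \<inter> (\<Inter>W\<in>E. subspace_stab G W) = {g \<in> G. \<forall>W\<in>E. g ` W = W}"
    by (auto simp: subspace_stab_def)
  have fix_inv: "(inv\<^bsub>general_linear scale\<^esub> g) ` W = W" if "g \<in> G" "g ` W = W" for g W
  proof -
    have "inv\<^bsub>general_linear scale\<^esub> g \<circ> g = id"
      using GL.l_inv[OF G.mem_carrier[OF \<open>g \<in> G\<close>]] by (simp add: general_linear_def)
    then have "(inv\<^bsub>general_linear scale\<^esub> g) ` (g ` W) = W" by (simp add: image_comp)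
    then show ?thesis by (simp add: that)
  qed
  have mult: "f \<otimes>\<^bsub>general_linear scale\<^esub> g = f \<circ> g" for f g
    by (simp add: general_linear_def)
  have one: "\<one>\<^bsub>general_linear scale\<^esub> = id"
    by (simp add: general_linear_def)
  show ?thesis
    unfolding eq
  proof (rule GL.subgroupI)
    show "{g \<in> G. \<forall>W\<in>E. g ` W = W} \<noteq> {}" using G.one_closed by (auto simp: one)
  next
    fix f g assume fg: "f \<in> {g \<in> G. \<forall>W\<in>E. g ` W = W}" "g \<in> {g \<in> G. \<forall>W\<in>E. g ` W = W}"
    have "(f \<circ> g) ` W = W" if "W \<in> E" for W
      unfolding image_comp[symmetric] using fg that by simp
    moreover have "f \<circ> g \<in> G"
      using G.m_closed[of f g] fg by (simp add: mult)
    ultimately show "f \<otimes>\<^bsub>general_linear scale\<^esub> g \<in> {g \<in> G. \<forall>W\<in>E. g ` W = W}"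
      unfolding mult by blast
  qed (use G.subset fix_inv in auto)
qed

lemma stab_set_eq_image:
  assumes "H \<subseteq> G"
  shows "stab_set scale G H = subspace_stab G ` invariant_subspaces scale H"
proof -
  have "H \<subseteq> subspace_stab G W \<longleftrightarrow> (\<forall>h\<in>H. h ` W = W)" for W
    unfolding subspace_stab_def using assms by blast
  then show ?thesis
    unfolding stab_set_def invariant_subspaces_def by blast
qed

lemma linear_reducible_iff_invariant_subspaces:
  "linear_reducible scale H \<longleftrightarrow> invariant_subspaces scale H \<noteq> {}"
  by (auto simp: linear_reducible_def invariant_subspaces_def)

text \<open>
  The indexing \<open>\<phi>\<close> of the stabilizers is left open so that it can be taken to be the identity on
  stabilizers or the map from an invariant subspace to its stabilizer.
\<close>

lemma minus_moebius_reducible_interval_hat: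
  fixes scale :: "'k::field \<Rightarrow> 'v::ab_group_add \<Rightarrow> 'v"
    and \<phi> :: "'i \<Rightarrow> ('v \<Rightarrow> 'v) set"
  assumes vs: "vector_space scale" and fin: "finite (UNIV :: 'v set)"
    and G: "subgroup G (general_linear scale)" "linear_irreducible scale G"
    and H: "subgroup H (general_linear scale)" "H \<subset> G"
    and A: "finite A" "\<phi> ` A = stab_set scale G H"
  shows "- moebius (reducible_interval_hat scale G H) H G
           = (\<Sum>E | E \<subseteq> A \<and> G \<inter> (\<Inter>a\<in>E. \<phi> a) \<noteq> H. (- 1) ^ card E)"
proof (cases "linear_reducible scale H")
  case False
  then have "A = {}"
    using A H by (simp add: stab_set_eq_image linear_reducible_iff_invariant_subspaces psubset_imp_subset)
  then have "{E. E \<subseteq> A \<and> G \<inter> (\<Inter>a\<in>E. \<phi> a) \<noteq> H} = {{}}"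
    using H by auto
  moreover have "{t \<in> {H, G}. H \<le> t \<and> t < G} = {H}" using H by auto
  then have "moebius {H, G} H G = - 1"
    using H by (subst moebius.simps) (auto simp: moebius_refl)
  ultimately show ?thesis
    using False by (simp add: reducible_interval_hat_def)
next
  case True
  have "finite (UNIV :: ('v \<Rightarrow> 'v) set)"
    using finite_set_of_finite_funs[OF fin fin, of undefined] by simp
  then have finite_sets: "finite S" for S :: "('v \<Rightarrow> 'v) set set"
    by (rule finite_set_of_sets)
  have stabs: "stab_set scale G H = subspace_stab G ` invariant_subspaces scale H"
    using H by (simp add: stab_set_eq_image psubset_imp_subset)
  let ?P = "reducible_interval_hat scale G H"
  have P: "?P = reducible_interval scale G H \<union> {G}"
    using True by (simp add: reducible_interval_hat_def)
  show ?thesis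
  proof (rule minus_moebius_eq_alternating_sum)
    obtain W where "W \<in> invariant_subspaces scale H"
      using True by (auto simp: linear_reducible_iff_invariant_subspaces)
    moreover from this have "H \<subseteq> subspace_stab G W"
      using H by (auto simp: invariant_subspaces_def subspace_stab_def)
    ultimately show "H \<in> ?P"
      using H by (auto simp: P reducible_interval_def stabs)
  next
    show "H \<subseteq> K \<and> K \<subseteq> G" if "K \<in> ?P" for K
      using that H by (auto simp: P reducible_interval_def)
  next
    fix E assume "E \<subseteq> A"
    show "G \<inter> (\<Inter>a\<in>E. \<phi> a) \<in> ?P"
    proof (cases "E = {}")
      case False
      then obtain a where "a \<in> E" by blast
      have sub: "\<phi> ` E \<subseteq> subspace_stab G ` invariant_subspaces scale H"
        using \<open>E \<subseteq> A\<close> A stabs by auto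
      then obtain F where F: "\<phi> ` E = subspace_stab G ` F"
        by (auto simp: subset_image_iff)
      have "subgroup (G \<inter> (\<Inter>a\<in>E. \<phi> a)) (general_linear scale)"
        unfolding F by (rule subgroup_Int_subspace_stabs[OF vs G(1)])
      moreover have "\<phi> a \<in> stab_set scale G H" using \<open>a \<in> E\<close> \<open>E \<subseteq> A\<close> A by auto
      moreover have "H \<subseteq> G \<inter> (\<Inter>a\<in>E. \<phi> a)"
        using sub H by (fastforce simp: invariant_subspaces_def subspace_stab_def)
      ultimately show ?thesis
        using \<open>a \<in> E\<close> by (auto simp: P reducible_interval_def intro!: bexI[of _ "\<phi> a"])
    qed (simp add: P)
  next
    show "\<exists>a\<in>A. K \<subseteq> \<phi> a" if "K \<in> ?P" "K \<noteq> G" for K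
      using that by (auto simp: P reducible_interval_def simp flip: A(2))
  next
    fix a assume "a \<in> A"
    then have "\<phi> a \<in> stab_set scale G H" using A by auto
    then obtain W where W: "W \<in> proper_subspaces scale" and a: "\<phi> a = subspace_stab G W"
      unfolding stab_set_def by blast
    obtain g where "g \<in> G" "g ` W \<noteq> W"
      using G(2) W unfolding linear_reducible_def by metis
    then have "g \<notin> \<phi> a" by (simp add: a subspace_stab_def)
    then show "\<not> G \<subseteq> \<phi> a" using \<open>g \<in> G\<close> by blast
  qed (use A H finite_sets in \<open>auto simp: P\<close>)
qed

theorem theorem4p5:
  fixes scale :: "'k::{field,finite} \<Rightarrow> 'v::ab_group_add \<Rightarrow> 'v"
    and Basis :: "'v set"
    and G H :: "('v \<Rightarrow> 'v) set"
  assumes "finite_dimensional_vector_space scale Basis"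
    and "subgroup G (general_linear scale)"
    and "linear_irreducible scale G"
    and "subgroup H (general_linear scale)"
    and "H \<subset> G"
  shows "- moebius (reducible_interval_hat scale G H) H G
           = (\<Sum>E\<in>Psi_subspaces scale G H. (- 1) ^ card E)
       \<and> (\<Sum>E\<in>Psi_subspaces scale G H. (- 1) ^ card E)
           = ((\<Sum>X\<in>Psi_stabs scale G H. (- 1) ^ card X) :: int)
       \<and> (\<Sum>X\<in>Psi_stabs scale G H. (- 1) ^ card X)
           = - reduced_euler_char (Delta1 scale G H)
       \<and> - reduced_euler_char (Delta1 scale G H)
           = - reduced_euler_char (Delta2 scale G H)"
proof -
  interpret finite_dimensional_vector_space scale Basis by fact
  have vs: "vector_space scale" by unfold_locales
  have fin: "finite (UNIV :: 'v set)"
    using assms(1) by (rule finite_UNIV_if_finite_dimensional)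
  then have fin_inv: "finite (invariant_subspaces scale H)"
    by (rule finite_set_of_sets)
  have stabs: "stab_set scale G H = subspace_stab G ` invariant_subspaces scale H"
    using assms by (simp add: stab_set_eq_image psubset_imp_subset)
  then have fin_stabs: "finite (stab_set scale G H)" using fin_inv by simp
  note crosscut = minus_moebius_reducible_interval_hat[OF vs fin assms(2-5)]
  have subspaces: "- moebius (reducible_interval_hat scale G H) H G
      = (\<Sum>E\<in>Psi_subspaces scale G H. (- 1) ^ card E)"
    using crosscut[OF fin_inv stabs[symmetric]] by (simp add: Psi_subspaces_def)
  have stabilizers: "- moebius (reducible_interval_hat scale G H) H G
      = (\<Sum>X\<in>Psi_stabs scale G H. (- 1) ^ card X)"
    using crosscut[OF fin_stabs image_ident] by (simp add: Psi_stabs_def)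
  have "- reduced_euler_char (Delta1 scale G H) = (\<Sum>E\<in>Psi_subspaces scale G H. (- 1) ^ card E)"
    using minus_reduced_euler_char[of "Delta1 scale G H"] fin_inv assms(5)
    by (auto simp: Delta1_def Psi_subspaces_def intro: finite_subset)
  moreover have "- reduced_euler_char (Delta2 scale G H) = (\<Sum>X\<in>Psi_stabs scale G H. (- 1) ^ card X)"
    using minus_reduced_euler_char[of "Delta2 scale G H"] fin_stabs assms(5)
    by (auto simp: Delta2_def Psi_stabs_def intro: finite_subset)
  ultimately show ?thesis
    using subspaces stabilizers by simp
qed

end
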